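(* Let $X$ be a linear 2-normed space over $\mathbb{K}$ ($\mathbb{K}=\mathbb{R}$ or $\mathbb{C}$) and let $b\in X$ be fixed. If a b-linear functional $T$ on $X\times\langle b\rangle$ is continuous at $0$, then it is continuous on the whole space $X$ (i.e. at every point of $X$).
   Context: Let $X$ be a linear space of dimension greater than $1$ over $\mathbb{K}$. A 2-norm on $X$ is a function $\|\cdot,\cdot\|:X\times X\to\mathbb{R}$ such that: (N1) $\|x,y\|=0$ if and only if $x,y$ are linearly dependent; (N2) $\|x,y\|=\|y,x\|$; (N3) $\|\alpha x,y\|=|\alpha|\,\|x,y\|$ for all $\alpha\in\mathbb{K}$; (N4) $\|x,y+z\|\le\|x,y\|+\|x,z\|$. The pair $(X,\|\cdot,\cdot\|)$ is then called a linear 2-normed space. For fixed $b\in X$, $\langle b\rangle$ is the subspace of $X$ generated by $b$. A b-linear functional on $X\times\langle b\rangle$ is a map $T:X\times\langle b\rangle\to\mathbb{K}$ with $T(x+y,b)=T(x,b)+T(y,b)$ and $T(kx,b)=kT(x,b)$ for all $x,y\in X$, $k\in\mathbb{K}$. A b-linear functional $T:X\times\langle b\rangle\to\mathbb{K}$ is continuous at $x_0\in X$ if for every $\epsilon>0$ there exist some $e\in X$ and $\delta>0$ such that for all $x\in X$, $\|x-x_0,e\|<\delta$ implies $|T(x,b)-T(x_0,b)|<\epsilon$. *)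

theory Defs
  imports Complex_Main
begin

text \<open>
  The scalar field is a type of class \<open>real_normed_field\<close>, so that real and complex scalars
  are covered by one set of definitions; \<open>norm\<close> on scalars is the absolute value.

  The library's \<open>dim\<close> is \<open>0\<close> for infinite-dimensional spaces, so the dimension condition
  \<open>dim_gt_1\<close> is expressed by a basis.  Linear dependence in \<open>N1\<close> is that of the pair
  \<open>(x, y)\<close> as a family (the library's \<open>dependent {x, y}\<close> would collapse \<open>x = y\<close> to
  a singleton).
\<close>

locale two_normed_space = vector_space scale
  for scale :: "'k::real_normed_field \<Rightarrow> 'a::ab_group_add \<Rightarrow> 'a" (infixr "*s" 75) +
  fixes norm2 :: "'a \<Rightarrow> 'a \<Rightarrow> real"
  assumes dim_gt_1: "\<exists>B. independent B \<and> span B = UNIV \<and> (infinite B \<or> card B > 1)"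
    and N1: "norm2 x y = 0 \<longleftrightarrow> (\<exists>\<alpha> \<beta>. (\<alpha> \<noteq> 0 \<or> \<beta> \<noteq> 0) \<and> \<alpha> *s x + \<beta> *s y = 0)"
    and N2: "norm2 x y = norm2 y x"
    and N3: "norm2 (\<alpha> *s x) y = norm \<alpha> * norm2 x y"
    and N4: "norm2 x (y + z) \<le> norm2 x y + norm2 x z"

text \<open>
  A functional on \<open>X \<times> \<langle>b\<rangle>\<close> is represented by a total function on pairs; its values at
  \<open>(x, c)\<close> with \<open>c\<close> outside the span of \<open>b\<close> are arbitrary and never used.
\<close>

definition b_linear_functional ::
  "('k::real_normed_field \<Rightarrow> 'a::ab_group_add \<Rightarrow> 'a) \<Rightarrow> 'a \<Rightarrow> ('a \<times> 'a \<Rightarrow> 'k) \<Rightarrow> bool"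
where
  "b_linear_functional scale b T \<longleftrightarrow>
     (\<forall>x y. T (x + y, b) = T (x, b) + T (y, b)) \<and>
     (\<forall>k x. T (scale k x, b) = k * T (x, b))"

definition b_continuous_at ::
  "('a::ab_group_add \<Rightarrow> 'a \<Rightarrow> real) \<Rightarrow> 'a \<Rightarrow> ('a \<times> 'a \<Rightarrow> 'k::real_normed_field) \<Rightarrow> 'a \<Rightarrow> bool"
where
  "b_continuous_at norm2 b T x0 \<longleftrightarrow>
     (\<forall>\<epsilon>>0. \<exists>e. \<exists>\<delta>>0. \<forall>x. norm2 (x - x0) e < \<delta> \<longrightarrow> norm (T (x, b) - T (x0, b)) < \<epsilon>)"

end

theory Submission
  imports Defs
begin

text \<open>Continuity of an additive map is translation invariant. By
  \<open>b_linear_functional_diff\<close>, \<open>T (x, b) - T (x0, b)\<close> equals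
  \<open>T (x - x0, b)\<close>, so the condition at \<open>x0\<close> is the condition at 0 read at
  \<open>x - x0\<close>, and the same \<open>e\<close> and \<delta> serve every point.
  \<open>b_continuous_at_zero_imp_b_continuous_at\<close> carries this out over any real normed
  field.\<close>

lemma b_linear_functional_diff:
  assumes "b_linear_functional scale b T"
  shows "T (x - y, b) = T (x, b) - T (y, b)"
proof -
  have "T (x - y + y, b) = T (x - y, b) + T (y, b)"
    using assms unfolding b_linear_functional_def by blast
  then show ?thesis by simp
qed

lemma b_continuous_at_zero_imp_b_continuous_at:
  assumes lin: "b_linear_functional scale b T" and cont: "b_continuous_at norm2 b T 0"
  shows "b_continuous_at norm2 b T x0"
proof -
  \<comment> \<open>With this, the base value and the shift by 0 disappear from the hypothesis at
    0.\<close>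
  have "T (0, b) = 0"
    using b_linear_functional_diff[OF lin, of 0 0] by simp
  then have "\<exists>e. \<exists>\<delta>>0. \<forall>x. norm2 x e < \<delta> \<longrightarrow> norm (T (x, b)) < \<epsilon>" if "\<epsilon> > 0" for \<epsilon>
    using cont that by (simp add: b_continuous_at_def)
  then show ?thesis
    \<comment> \<open>Merging the difference into \<open>T (x - x0, b)\<close> makes the goal the
      bound at 0, instantiated at \<open>x - x0\<close>.\<close>
    unfolding b_continuous_at_def b_linear_functional_diff[OF lin, symmetric] by blast
qed

theorem theorem4p6:
  "(\<forall>(scale :: real \<Rightarrow> 'a::ab_group_add \<Rightarrow> 'a) (norm2 :: 'a \<Rightarrow> 'a \<Rightarrow> real) (b :: 'a) (T :: 'a \<times> 'a \<Rightarrow> real).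
      two_normed_space scale norm2 \<longrightarrow> b_linear_functional scale b T \<longrightarrow>
      b_continuous_at norm2 b T 0 \<longrightarrow> (\<forall>x0. b_continuous_at norm2 b T x0)) \<and>
   (\<forall>(scale :: complex \<Rightarrow> 'b::ab_group_add \<Rightarrow> 'b) (norm2 :: 'b \<Rightarrow> 'b \<Rightarrow> real) (b :: 'b) (T :: 'b \<times> 'b \<Rightarrow> complex).
      two_normed_space scale norm2 \<longrightarrow> b_linear_functional scale b T \<longrightarrow>
      b_continuous_at norm2 b T 0 \<longrightarrow> (\<forall>x0. b_continuous_at norm2 b T x0))"
  \<comment> \<open>Both conjuncts are type instances of one lemma, polymorphic in the scalar
    field.\<close>
  by (blast intro: b_continuous_at_zero_imp_b_continuous_at)

end
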